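(* Let $\mathbf{A}=[a_{ij}]$ be a pairwise comparison matrix of size $n\times n$, and let $\mathbf{w}$ be its principal right eigenvector, i.e. the (unique up to positive scaling) positive vector satisfying $\mathbf{A}\mathbf{w}=\lambda_{\max}\mathbf{w}$, where $\lambda_{\max}$ is the Perron (largest) eigenvalue of $\mathbf{A}$. Then $\mathbf{w}$ is weakly efficient with respect to $\mathbf{A}$.
   Context: A pairwise comparison matrix of size $n\times n$ ($n\ge 3$) is a real matrix $\mathbf{A}=[a_{ij}]$ with all entries positive and $a_{ij}=1/a_{ji}$ for all $1\le i,j\le n$ (so $a_{ii}=1$). A positive weight vector $\mathbf{w}=(w_1,\dots,w_n)^{\top}$ is called weakly efficient (with respect to $\mathbf{A}$) if there is no positive vector $\mathbf{w}'=(w'_1,\dots,w'_n)^{\top}$ such that $$\left|a_{ij}-\frac{w'_i}{w'_j}\right|<\left|a_{ij}-\frac{w_i}{w_j}\right|\quad\text{for all } 1\le i\ne j\le n.$$ *)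

theory Defs
  imports "Jordan_Normal_Form.Spectral_Radius"
begin

definition pairwise_comparison_matrix :: "nat \<Rightarrow> real mat \<Rightarrow> bool" where
  "pairwise_comparison_matrix n A \<longleftrightarrow>
     A \<in> carrier_mat n n \<and>
     (\<forall>i<n. \<forall>j<n. A $$ (i, j) > 0 \<and> A $$ (i, j) = 1 / A $$ (j, i))"

definition positive_vector :: "nat \<Rightarrow> real vec \<Rightarrow> bool" where
  "positive_vector n w \<longleftrightarrow> w \<in> carrier_vec n \<and> (\<forall>i<n. w $ i > 0)"

(* The largest modulus of a complex eigenvalue. For an entrywise positive matrix it is
   itself an eigenvalue (Perron), and hence also the largest real eigenvalue. *)
definition perron_eigenvalue :: "real mat \<Rightarrow> real" where
  "perron_eigenvalue A = spectral_radius (map_mat complex_of_real A)"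

(* Determined only up to a positive factor; no normalization of w is chosen. *)
definition principal_right_eigenvector :: "nat \<Rightarrow> real mat \<Rightarrow> real vec \<Rightarrow> bool" where
  "principal_right_eigenvector n A w \<longleftrightarrow>
     positive_vector n w \<and> eigenvector A w (perron_eigenvalue A)"

definition weakly_efficient :: "nat \<Rightarrow> real mat \<Rightarrow> real vec \<Rightarrow> bool" where
  "weakly_efficient n A w \<longleftrightarrow>
     positive_vector n w \<and>
     \<not> (\<exists>w'. positive_vector n w' \<and>
          (\<forall>i<n. \<forall>j<n. i \<noteq> j \<longrightarrow>
             \<bar>A $$ (i, j) - w' $ i / w' $ j\<bar> < \<bar>A $$ (i, j) - w $ i / w $ j\<bar>))"

end

theory Submission
  imports Defs
begin

text \<open>If \<open>w'\<close> improves every off-diagonal entry strictly, then comparing at a minimizer and a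
  maximizer of \<open>w'\<^sub>i / w\<^sub>i\<close> gives a row \<open>i\<close> with \<open>a\<^sub>i\<^sub>j w\<^sub>j < w\<^sub>i\<close> for all \<open>j \<noteq> i\<close> and a row \<open>k\<close>
  with \<open>a\<^sub>k\<^sub>j w\<^sub>j > w\<^sub>k\<close> for all \<open>j \<noteq> k\<close>. Summing over \<open>j\<close>, the first row forces the eigenvalue to be
  smaller than \<open>n\<close> and the second forces it to be larger.\<close>

lemma eigenvector_row_sum:
  assumes "A \<in> carrier_mat n n" "eigenvector A w l" "i < n"
  shows "(\<Sum>j<n. A $$ (i, j) * w $ j) = l * w $ i"
proof -
  have w: "w \<in> carrier_vec n" and eq: "A *\<^sub>v w = l \<cdot>\<^sub>v w"
    using assms by (auto simp: eigenvector_def)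
  have "(A *\<^sub>v w) $ i = (\<Sum>j<n. A $$ (i, j) * w $ j)"
    using assms w by (auto simp: scalar_prod_def atLeast0LessThan)
  then show ?thesis
    using eq w assms(3) by simp
qed

text \<open>The last hypothesis says that the new ratio \<open>u' / v'\<close> is at most
  \<open>u / v\<close>. If \<open>a\<close> were at least \<open>u / v\<close>, going down would not
  bring the ratio closer to \<open>a\<close>, so \<open>a\<close> must lie strictly below
  \<open>u / v\<close>.\<close>

lemma strict_improvement_lower:
  fixes a u v u' v' :: real
  assumes "u > 0" "v > 0" "u' > 0" "v' > 0"
    and "\<bar>a - u' / v'\<bar> < \<bar>a - u / v\<bar>" and "u' / u \<le> v' / v"
  shows "a * v < u"
proof -
  have "u' / v' \<le> u / v"
    using assms by (simp add: field_simps)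
  then have "a < u / v"
    using assms(5) by linarith
  then show ?thesis
    using assms(2) by (simp add: pos_less_divide_eq)
qed

text \<open>Mirror case: the ratio does not decrease, so getting closer forces \<open>a\<close>
  above \<open>u / v\<close>.\<close>

lemma strict_improvement_upper:
  fixes a u v u' v' :: real
  assumes "u > 0" "v > 0" "u' > 0" "v' > 0"
    and "\<bar>a - u' / v'\<bar> < \<bar>a - u / v\<bar>" and "v' / v \<le> u' / u"
  shows "u < a * v"
proof -
  have "u / v \<le> u' / v'"
    using assms by (simp add: field_simps)
  then have "u / v < a"
    using assms(5) by linarith
  then show ?thesis
    using assms(2) by (simp add: pos_divide_less_eq)
qed

theorem theorem3p1:
  fixes n :: nat and A :: "real mat" and w :: "real vec"
  assumes "n \<ge> 3"
    and "pairwise_comparison_matrix n A"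
    and "principal_right_eigenvector n A w"
  shows "weakly_efficient n A w"
proof -
  define l where "l = perron_eigenvalue A"
  have w: "positive_vector n w" and ev: "eigenvector A w l"
    using assms(3) by (auto simp: principal_right_eigenvector_def l_def)
  have wpos: "w $ i > 0" if "i < n" for i
    using w that by (simp add: positive_vector_def)
  have A: "A \<in> carrier_mat n n"
    using assms(2) by (simp add: pairwise_comparison_matrix_def)
  have diag: "A $$ (i, i) = 1" if "i < n" for i
  proof -
    have pos: "A $$ (i, i) > 0" and inv: "A $$ (i, i) = 1 / A $$ (i, i)"
      using assms(2) that unfolding pairwise_comparison_matrix_def by blast+
    have "A $$ (i, i) * A $$ (i, i) = 1"
      by (rule nonzero_eq_divide_eq[THEN iffD1, OF _ inv]) (rule less_imp_neq[OF pos, symmetric])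
    then show ?thesis
      using pos square_eq_1_iff[of "A $$ (i, i)"] by linarith
  qed
  note row = eigenvector_row_sum[OF A ev]
  have False
    if w': "positive_vector n w'"
      and imp: "\<forall>i<n. \<forall>j<n. i \<noteq> j \<longrightarrow>
        \<bar>A $$ (i, j) - w' $ i / w' $ j\<bar> < \<bar>A $$ (i, j) - w $ i / w $ j\<bar>" for w'
  proof -
    \<comment> \<open>Comparing \<open>r i\<close> with \<open>r j\<close> tells in which direction
      the ratio of entries \<open>i\<close> and \<open>j\<close> moves from \<open>w\<close> to
      \<open>w'\<close>. At an extremal index this direction is the same along the whole
      row.\<close>
    define r where "r i = w' $ i / w $ i" for i
    have wpos': "w' $ i > 0" if "i < n" for i
      using w' that by (simp add: positive_vector_def)
    have "0 \<in> {..<n}"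
      using assms(1) by simp
    then have ne: "{..<n} \<noteq> {}"
      by blast
    obtain i where i: "i < n" and imin: "\<And>j. j < n \<Longrightarrow> r i \<le> r j"
      using ex_is_arg_min_if_finite[of "{..<n}" r] ne
      by (auto simp: is_arg_min_linorder)
    \<comment> \<open>A maximizer of \<open>r\<close> is obtained as a minimizer of
      \<open>- r\<close>.\<close>
    obtain k where k: "k < n" and kmax: "\<And>j. j < n \<Longrightarrow> r j \<le> r k"
      using ex_is_arg_min_if_finite[of "{..<n}" "\<lambda>j. - r j"] ne
      by (auto simp: is_arg_min_linorder)
    have low: "A $$ (i, j) * w $ j < w $ i" if "j < n" "j \<noteq> i" for j
      using strict_improvement_lower[of "w $ i" "w $ j" "w' $ i" "w' $ j"]
        wpos[OF i] wpos'[OF i] wpos[OF that(1)] wpos'[OF that(1)]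
        imp[rule_format, OF i that(1) that(2)[symmetric]] imin[OF that(1)]
      by (simp add: r_def)
    have up: "w $ k < A $$ (k, j) * w $ j" if "j < n" "j \<noteq> k" for j
      using strict_improvement_upper[of "w $ k" "w $ j" "w' $ k" "w' $ j"]
        wpos[OF k] wpos'[OF k] wpos[OF that(1)] wpos'[OF that(1)]
        imp[rule_format, OF k that(1) that(2)[symmetric]] kmax[OF that(1)]
      by (simp add: r_def)
    have other: "\<exists>j<n. j \<noteq> m" for m
      using assms(1) by (intro exI[of _ "if m = 0 then 1 else 0"]) auto
    \<comment> \<open>The diagonal term gives equality because \<open>A $$ (i, i) = 1\<close>;
      strictness comes from an off-diagonal index supplied by \<open>other\<close>.\<close>
    have "(\<Sum>j<n. A $$ (i, j) * w $ j) < (\<Sum>j<n. w $ i)"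
    proof (rule sum_strict_mono_ex1)
      show "\<forall>j\<in>{..<n}. A $$ (i, j) * w $ j \<le> w $ i"
        using low diag[OF i] by (metis lessThan_iff less_imp_le mult_1 order_refl)
      show "\<exists>j\<in>{..<n}. A $$ (i, j) * w $ j < w $ i"
        using low other by blast
    qed simp
    \<comment> \<open>The two sums equal \<open>l * w $ i\<close> and \<open>n * w $ i\<close>, and
      the positive factor \<open>w $ i\<close> cancels.\<close>
    then have "l < n"
      using row[OF i] wpos[OF i] by simp
    have "(\<Sum>j<n. w $ k) < (\<Sum>j<n. A $$ (k, j) * w $ j)"
    proof (rule sum_strict_mono_ex1)
      show "\<forall>j\<in>{..<n}. w $ k \<le> A $$ (k, j) * w $ j"
        using up diag[OF k] by (metis lessThan_iff less_imp_le mult_1 order_refl)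
      show "\<exists>j\<in>{..<n}. w $ k < A $$ (k, j) * w $ j"
        using up other by blast
    qed simp
    then have "n < l"
      using row[OF k] wpos[OF k] by simp
    with \<open>l < n\<close> show False
      by simp
  qed
  then show ?thesis
    using w unfolding weakly_efficient_def by blast
qed

end
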